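(* There exists a unique $D_6$-action on the Racah algebra $\Re$ such that each of the following holds: (i) $\sigma$ acts on $\Re$ as an $\mathbb F$-algebra antiautomorphism sending $$A\mapsto B,\quad B\mapsto A,\quad C\mapsto C,\quad D\mapsto D,\quad \alpha\mapsto-\beta,\quad \beta\mapsto-\alpha,\quad \gamma\mapsto-\gamma,\quad \delta\mapsto\delta;$$ (ii) $\tau$ acts on $\Re$ as an $\mathbb F$-algebra antiautomorphism sending $$A\mapsto B,\quad B\mapsto C,\quad C\mapsto A,\quad D\mapsto -D,\quad \alpha\mapsto\beta,\quad \beta\mapsto\gamma,\quad \gamma\mapsto\alpha,\quad \delta\mapsto\delta.$$
   Context: $\mathbb F$ is a field with $\operatorname{char}\mathbb F\neq 2$. All algebras are unital and associative. Write $[x,y]=xy-yx$. The Racah algebra $\Re$ is the $\mathbb F$-algebra defined by generators $A,B,C,D$ and the relations $[A,B]=[B,C]=[C,A]=2D$ together with the relations asserting that each of the elements $$\alpha=[A,D]+AC-BA,\qquad \beta=[B,D]+BA-CB,\qquad \gamma=[C,D]+CB-AC$$ is central in $\Re$. Set $\delta=A+B+C$. $D_6$ is the dihedral group with generators $\sigma,\tau$ and relations $\sigma^2=1$, $\tau^6=1$, $(\sigma\tau)^2=1$. *)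

theory Defs
  imports Complex_Main "HOL-Library.Poly_Mapping" "HOL-Algebra.Group_Action"
begin

definition commutator :: "'a::ring \<Rightarrow> 'a \<Rightarrow> 'a"
  where "commutator x y = x * y - y * x"


section \<open>The free algebra on four generators\<close>

text \<open>
  Lists with concatenation are the free monoid, so the finitely supported functions from
  lists to \<open>'f\<close>, with the convolution product of \<^theory>\<open>HOL-Library.Poly_Mapping\<close>, are the
  free unital associative \<open>'f\<close>-algebra on the list entries.
\<close>

instantiation list :: (type) monoid_add
begin

definition zero_list :: "'a list" where "zero_list = []"
definition plus_list :: "'a list \<Rightarrow> 'a list \<Rightarrow> 'a list" where "plus_list = (@)"

instance
  by standard (simp_all add: zero_list_def plus_list_def)

end

datatype racah_gen = Gen_A | Gen_B | Gen_C | Gen_D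

type_synonym 'f racah_free = "racah_gen list \<Rightarrow>\<^sub>0 'f"

definition free_gen :: "racah_gen \<Rightarrow> 'f::field racah_free"
  where "free_gen g = Poly_Mapping.single [g] 1"

abbreviation "free_A \<equiv> free_gen Gen_A"
abbreviation "free_B \<equiv> free_gen Gen_B"
abbreviation "free_C \<equiv> free_gen Gen_C"
abbreviation "free_D \<equiv> free_gen Gen_D"

definition free_alpha :: "'f::field racah_free"
  where "free_alpha = commutator free_A free_D + free_A * free_C - free_B * free_A"

definition free_beta :: "'f::field racah_free"
  where "free_beta = commutator free_B free_D + free_B * free_A - free_C * free_B"

definition free_gamma :: "'f::field racah_free"
  where "free_gamma = commutator free_C free_D + free_C * free_B - free_A * free_C"


section \<open>The Racah algebra\<close>

text \<open>An equation \<open>p = q\<close> among the defining relations is encoded as the element \<open>p - q\<close>.\<close>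

definition racah_relators :: "'f::field racah_free set"
  where "racah_relators =
    {commutator free_A free_B - 2 * free_D,
     commutator free_B free_C - 2 * free_D,
     commutator free_C free_A - 2 * free_D}
    \<union> range (commutator free_alpha)
    \<union> range (commutator free_beta)
    \<union> range (commutator free_gamma)"

text \<open>The two-sided ideal generated by the relators:\<close>

inductive_set racah_ideal :: "'f::field racah_free set"
  where
    zero: "0 \<in> racah_ideal"
  | relator: "r \<in> racah_relators \<Longrightarrow> x * r * y \<in> racah_ideal"
  | add: "p \<in> racah_ideal \<Longrightarrow> q \<in> racah_ideal \<Longrightarrow> p + q \<in> racah_ideal"

lemma racah_ideal_mult_left: "p \<in> racah_ideal \<Longrightarrow> z * p \<in> racah_ideal"
proof (induction rule: racah_ideal.induct)
  case (relator r x y)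
  then show ?case
    using racah_ideal.relator[of r "z * x" y] by (simp add: mult.assoc)
qed (auto simp: distrib_left intro: racah_ideal.zero racah_ideal.add)

lemma racah_ideal_mult_right: "p \<in> racah_ideal \<Longrightarrow> p * z \<in> racah_ideal"
proof (induction rule: racah_ideal.induct)
  case (relator r x y)
  then show ?case
    using racah_ideal.relator[of r x "y * z"] by (simp add: mult.assoc)
qed (auto simp: distrib_right intro: racah_ideal.zero racah_ideal.add)

lemma racah_ideal_uminus: "p \<in> racah_ideal \<Longrightarrow> - p \<in> racah_ideal"
  using racah_ideal_mult_left[of p "- 1"] by simp

lemma racah_ideal_diff: "p \<in> racah_ideal \<Longrightarrow> q \<in> racah_ideal \<Longrightarrow> p - q \<in> racah_ideal"
  using racah_ideal.add[of p "- q"] racah_ideal_uminus[of q] by simp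

lemma lookup_mult_Nil:
  fixes p q :: "'f::field racah_free"
  shows "Poly_Mapping.lookup (p * q) [] = Poly_Mapping.lookup p [] * Poly_Mapping.lookup q []"
proof -
  have "(Poly_Mapping.lookup q u when [] = l + u) = (Poly_Mapping.lookup q [] when u = [] \<and> l = [])" for l u
    by (auto simp: when_def plus_list_def)
  then have *: "(\<Sum>u. Poly_Mapping.lookup q u when [] = l + u) = (Poly_Mapping.lookup q [] when l = [])" for l
    by (cases "l = []") simp_all
  show ?thesis
    unfolding times_poly_mapping.rep_eq prod_fun_def * mult_when by simp
qed

lemma lookup_racah_ideal_Nil: "p \<in> racah_ideal \<Longrightarrow> Poly_Mapping.lookup p [] = 0"
proof (induction rule: racah_ideal.induct)
  case (relator r x y)
  have "Poly_Mapping.lookup (free_gen g :: 'a racah_free) [] = 0" for g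
    by (simp add: free_gen_def lookup_single zero_list_def when_def)
  then have "Poly_Mapping.lookup r [] = 0"
    using relator
    by (auto simp: racah_relators_def commutator_def lookup_minus lookup_mult_Nil)
  then show ?case
    by (simp add: lookup_mult_Nil)
qed (simp_all add: lookup_add)

lemma one_notin_racah_ideal: "1 \<notin> racah_ideal"
  using lookup_racah_ideal_Nil[of 1] by (auto simp: lookup_one zero_list_def when_def)

definition racah_eq :: "'f::field racah_free \<Rightarrow> 'f racah_free \<Rightarrow> bool"
  where "racah_eq p q \<longleftrightarrow> p - q \<in> racah_ideal"

lemma equivp_racah_eq: "equivp racah_eq"
proof (rule equivpI)
  show "reflp racah_eq"
    by (simp add: reflp_def racah_eq_def racah_ideal.zero)
  show "symp racah_eq"
    unfolding symp_def racah_eq_def using racah_ideal_uminus by fastforce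
  show "transp racah_eq"
    unfolding transp_def racah_eq_def using racah_ideal.add by fastforce
qed

quotient_type (overloaded) 'f racah = "'f::field racah_free" / racah_eq
  by (rule equivp_racah_eq)

instantiation racah :: (field) ring_1
begin

lift_definition zero_racah :: "'a racah" is 0 .
lift_definition one_racah :: "'a racah" is 1 .
lift_definition plus_racah :: "'a racah \<Rightarrow> 'a racah \<Rightarrow> 'a racah" is "(+)"
  unfolding racah_eq_def using racah_ideal.add by (fastforce simp: algebra_simps)
lift_definition minus_racah :: "'a racah \<Rightarrow> 'a racah \<Rightarrow> 'a racah" is "(-)"
  unfolding racah_eq_def using racah_ideal_diff by (fastforce simp: algebra_simps)
lift_definition uminus_racah :: "'a racah \<Rightarrow> 'a racah" is uminus
  unfolding racah_eq_def using racah_ideal_uminus by fastforce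
lift_definition times_racah :: "'a racah \<Rightarrow> 'a racah \<Rightarrow> 'a racah" is "(*)"
proof -
  fix p p' q q' :: "'a racah_free"
  assume "racah_eq p p'" "racah_eq q q'"
  then have "(p - p') * q \<in> racah_ideal" "p' * (q - q') \<in> racah_ideal"
    by (auto simp: racah_eq_def racah_ideal_mult_left racah_ideal_mult_right)
  from racah_ideal.add[OF this] show "racah_eq (p * q) (p' * q')"
    by (simp add: racah_eq_def algebra_simps)
qed

instance
proof
  show "(0 :: 'a racah) \<noteq> 1"
    by transfer (use one_notin_racah_ideal racah_ideal_uminus in \<open>fastforce simp: racah_eq_def\<close>)
qed (transfer; simp add: racah_eq_def racah_ideal.zero algebra_simps)+

end

lift_definition scale_racah :: "'f::field \<Rightarrow> 'f racah \<Rightarrow> 'f racah"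
  is "\<lambda>c p. Poly_Mapping.single 0 c * p"
  by (metis racah_eq_def racah_ideal_mult_left right_diff_distrib)

lemma vector_space_scale_racah:
  "vector_space (scale_racah :: 'f::field \<Rightarrow> 'f racah \<Rightarrow> 'f racah)"
proof
  fix a b :: 'f and x y :: "'f racah"
  show "scale_racah a (x + y) = scale_racah a x + scale_racah a y"
    by transfer (simp add: racah_eq_def racah_ideal.zero distrib_left)
  show "scale_racah (a + b) x = scale_racah a x + scale_racah b x"
    by transfer (simp add: racah_eq_def racah_ideal.zero distrib_right single_add)
  show "scale_racah a (scale_racah b x) = scale_racah (a * b) x"
    by transfer (simp add: racah_eq_def racah_ideal.zero mult_single flip: mult.assoc)
  show "scale_racah 1 x = x"
    by transfer (simp add: racah_eq_def racah_ideal.zero)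
qed

lemma scale_racah_mult_left: "scale_racah c x * y = scale_racah c (x * y)"
  by transfer (simp add: racah_eq_def racah_ideal.zero mult.assoc)

lemma scale_racah_mult_right:
  fixes c :: "'f::field"
  shows "x * scale_racah c y = scale_racah c (x * y)"
proof transfer
  fix x y :: "'f racah_free" and c :: 'f
  have "x * Poly_Mapping.single 0 c = Poly_Mapping.single 0 c * x"
  proof (induction x rule: update_induct)
    case (update x w b)
    then have "Poly_Mapping.update w b x = x + Poly_Mapping.single w b"
      by (intro poly_mapping_eqI)
        (auto simp: lookup_update lookup_add lookup_single when_def not_in_keys_iff_lookup_eq_zero)
    with update show ?case
      by (simp add: mult_single distrib_left distrib_right mult.commute[of b])
  qed simp
  then show "racah_eq (x * (Poly_Mapping.single 0 c * y)) (Poly_Mapping.single 0 c * (x * y))"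
    by (simp add: racah_eq_def racah_ideal.zero flip: mult.assoc)
qed

lift_definition racah_A :: "'f::field racah" is free_A .
lift_definition racah_B :: "'f::field racah" is free_B .
lift_definition racah_C :: "'f::field racah" is free_C .
lift_definition racah_D :: "'f::field racah" is free_D .

definition racah_alpha :: "'f::field racah"
  where "racah_alpha = commutator racah_A racah_D + racah_A * racah_C - racah_B * racah_A"

definition racah_beta :: "'f::field racah"
  where "racah_beta = commutator racah_B racah_D + racah_B * racah_A - racah_C * racah_B"

definition racah_gamma :: "'f::field racah"
  where "racah_gamma = commutator racah_C racah_D + racah_C * racah_B - racah_A * racah_C"

definition racah_delta :: "'f::field racah"
  where "racah_delta = racah_A + racah_B + racah_C"


section \<open>Algebra antiautomorphisms\<close>

definition algebra_antiautomorphism ::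
    "('f::field \<Rightarrow> 'a::ring_1 \<Rightarrow> 'a) \<Rightarrow> ('a \<Rightarrow> 'a) \<Rightarrow> bool"
  where "algebra_antiautomorphism scale f \<longleftrightarrow>
    Vector_Spaces.linear scale scale f \<and> bij f \<and> f 1 = 1 \<and> (\<forall>x y. f (x * y) = f y * f x)"


section \<open>The dihedral group\<close>

text \<open>
  A word is a list of letters \<open>(g, b)\<close>, where \<open>(g, True)\<close> stands for the generator \<open>g\<close> and
  \<open>(g, False)\<close> for its inverse.  The group is the set of words modulo the least congruence
  containing free cancellation and the defining relations.
\<close>

datatype D6_gen = Gen_sigma | Gen_tau

type_synonym D6_word = "(D6_gen \<times> bool) list"

inductive D6_eq :: "D6_word \<Rightarrow> D6_word \<Rightarrow> bool"
  where
    refl: "D6_eq u u"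
  | sym: "D6_eq u v \<Longrightarrow> D6_eq v u"
  | trans: "D6_eq u v \<Longrightarrow> D6_eq v w \<Longrightarrow> D6_eq u w"
  | append: "D6_eq u u' \<Longrightarrow> D6_eq v v' \<Longrightarrow> D6_eq (u @ v) (u' @ v')"
  | cancel: "D6_eq [(g, b), (g, \<not> b)] []"
  | sigma_square: "D6_eq [(Gen_sigma, True), (Gen_sigma, True)] []"
  | tau_power6: "D6_eq (replicate 6 (Gen_tau, True)) []"
  | sigma_tau_square:
      "D6_eq [(Gen_sigma, True), (Gen_tau, True), (Gen_sigma, True), (Gen_tau, True)] []"

quotient_type D6 = D6_word / D6_eq
  by (intro equivpI reflpI sympI transpI) (auto intro: D6_eq.refl D6_eq.sym D6_eq.trans)

lift_definition D6_one :: D6 is "[]" .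
lift_definition D6_mult :: "D6 \<Rightarrow> D6 \<Rightarrow> D6" is "(@)"
  by (rule D6_eq.append)

lift_definition D6_sigma :: D6 is "[(Gen_sigma, True)]" .
lift_definition D6_tau :: D6 is "[(Gen_tau, True)]" .

definition D6_group :: "D6 monoid"
  where "D6_group = \<lparr>carrier = UNIV, mult = D6_mult, one = D6_one\<rparr>"

lemma D6_eq_cancel_rev: "D6_eq (rev (map (apsnd Not) w) @ w) []"
proof (induction w)
  case Nil
  then show ?case by (simp add: D6_eq.refl)
next
  case (Cons l w)
  obtain g b where l: "l = (g, b)" by (cases l)
  have "D6_eq (rev (map (apsnd Not) w) @ ([(g, \<not> b), (g, \<not> \<not> b)] @ w))
          (rev (map (apsnd Not) w) @ ([] @ w))"
    by (intro D6_eq.append D6_eq.cancel D6_eq.refl)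
  then show ?case
    using Cons by (auto simp: l intro: D6_eq.trans)
qed

lemma group_D6_group: "group D6_group"
proof (rule groupI)
  fix x assume "x \<in> carrier D6_group"
  have "\<exists>y. D6_mult y x = D6_one"
    by transfer (use D6_eq_cancel_rev in blast)
  then show "\<exists>y\<in>carrier D6_group. y \<otimes>\<^bsub>D6_group\<^esub> x = \<one>\<^bsub>D6_group\<^esub>"
    by (simp add: D6_group_def)
qed (simp_all add: D6_group_def, (transfer, simp add: D6_eq.refl)+)

end

theory Submission
  imports Defs
begin

text \<open>
  An antihomomorphism from \<open>\<Re>\<close> is the same as an assignment of the generators whose
  images satisfy the defining relations in the opposite algebra; this gives \<open>\<sigma>\<close> and \<open>\<tau>\<close>.
  The relations of the dihedral group are identities between (anti)homomorphisms, so they need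
  only be checked on \<open>A, B, C, D\<close>, and an action is determined by \<open>\<sigma>\<close> and \<open>\<tau>\<close>, which are
  in turn determined by their values on \<open>A, B, C, D\<close>.
\<close>

section \<open>Evaluation of noncommutative polynomials with reversed products\<close>

text \<open>The linear extension of a map on words; reversing each word makes it an antihomomorphism
  with values in \<Re> itself, so that no opposite algebra has to be built.\<close>

definition anti_eval :: "('g \<Rightarrow> 'f::field racah) \<Rightarrow> ('g list \<Rightarrow>\<^sub>0 'f) \<Rightarrow> 'f racah"
  where "anti_eval h p =
    (\<Sum>w\<in>Poly_Mapping.keys p. scale_racah (Poly_Mapping.lookup p w) (prod_list (map h (rev w))))"

interpretation racah: vector_space "scale_racah :: 'f::field \<Rightarrow> 'f racah \<Rightarrow> 'f racah"
  by (rule vector_space_scale_racah)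

text \<open>Coefficients vanish off the support. This puts polynomials with different supports over
  one index set, as additivity requires.\<close>

lemma anti_eval_superset:
  assumes "finite S" "Poly_Mapping.keys p \<subseteq> S"
  shows "anti_eval h p =
    (\<Sum>w\<in>S. scale_racah (Poly_Mapping.lookup p w) (prod_list (map h (rev w))))"
  unfolding anti_eval_def using assms
  by (intro sum.mono_neutral_left) (auto simp: in_keys_iff)

lemma anti_eval_add: "anti_eval h (p + q) = anti_eval h p + anti_eval h q"
proof -
  let ?S = "Poly_Mapping.keys p \<union> Poly_Mapping.keys q"
  have "Poly_Mapping.keys (p + q) \<subseteq> ?S"
    by (rule Poly_Mapping.keys_add)
  then show ?thesis
    by (simp add: anti_eval_superset[of ?S] lookup_add racah.scale_left_distrib sum.distrib)
qed

lemma anti_eval_single: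
  "anti_eval h (Poly_Mapping.single w c) = scale_racah c (prod_list (map h (rev w)))"
  by (subst anti_eval_superset[of "{w}"]) auto

lemma anti_eval_zero [simp]: "anti_eval h 0 = 0"
  by (simp add: anti_eval_def)

lemma anti_eval_diff: "anti_eval h (p - q) = anti_eval h p - anti_eval h q"
  using anti_eval_add[of h "p - q" q] by simp

lemma anti_eval_one: "anti_eval h 1 = 1"
  by (simp add: anti_eval_single zero_list_def flip: single_one)

text \<open>\<open>update_induct\<close> only updates at keys outside the support, where updating
  amounts to adding a monomial.\<close>

lemma poly_mapping_single_induct [case_names zero single]:
  assumes "P 0" and "\<And>p w c. P p \<Longrightarrow> P (p + Poly_Mapping.single w c)"
  shows "P (p :: 'a \<Rightarrow>\<^sub>0 'b::monoid_add)"
proof (induction p rule: update_induct)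
  case (update x w b)
  then have "Poly_Mapping.update w b x = x + Poly_Mapping.single w b"
    by (intro poly_mapping_eqI)
      (auto simp: lookup_update lookup_add lookup_single when_def not_in_keys_iff_lookup_eq_zero)
  with update show ?case
    by (simp add: assms)
qed (rule assms)

text \<open>Both sides are biadditive, which leaves two monomials: reversing a concatenation swaps
  its factors, and scalars commute with everything.\<close>

lemma anti_eval_mult: "anti_eval h (p * q) = anti_eval h q * anti_eval h p"
proof (induction p rule: poly_mapping_single_induct)
  case (single p w c)
  have "anti_eval h (Poly_Mapping.single w c * q) =
      anti_eval h q * anti_eval h (Poly_Mapping.single w c)"
    by (induction q rule: poly_mapping_single_induct)
      (simp_all add: distrib_left distrib_right anti_eval_add mult_single anti_eval_single
        plus_list_def scale_racah_mult_left scale_racah_mult_right racah.scale_right_distrib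
        mult.commute)
  with single show ?case
    by (simp add: distrib_left distrib_right anti_eval_add)
qed simp

lemma anti_eval_gen [simp]: "anti_eval h (free_gen g) = h g"
  by (simp add: free_gen_def anti_eval_single)

lemma anti_eval_commutator:
  "anti_eval h (commutator p q) = commutator (anti_eval h q) (anti_eval h p)"
  by (simp add: commutator_def anti_eval_diff anti_eval_mult)

section \<open>Relations in \<Re> and induction over its elements\<close>

lemma relator_in_racah_ideal: "r \<in> racah_relators \<Longrightarrow> r \<in> racah_ideal"
  using racah_ideal.relator[of r 1 1] by simp

lemma racah_commutators:
  "commutator racah_A racah_B = 2 * racah_D"
  "commutator racah_B racah_C = 2 * racah_D"
  "commutator racah_C racah_A = 2 * racah_D"
  unfolding commutator_def mult_2
  by (transfer; unfold racah_eq_def; rule relator_in_racah_ideal;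
      simp add: racah_relators_def commutator_def mult_2)+

lemma racah_central:
  "commutator racah_alpha x = 0"
  "commutator racah_beta x = 0"
  "commutator racah_gamma x = 0"
  unfolding racah_alpha_def racah_beta_def racah_gamma_def commutator_def
  by (transfer; unfold racah_eq_def; simp; rule relator_in_racah_ideal;
      force simp: racah_relators_def commutator_def free_alpha_def free_beta_def free_gamma_def)+

text \<open>Every element is the class of a linear combination of words in the generators.\<close>

lemma racah_induct [case_names one A B C D add scale mult]:
  assumes "P 1" "P racah_A" "P racah_B" "P racah_C" "P racah_D"
    and add: "\<And>x y. P x \<Longrightarrow> P y \<Longrightarrow> P (x + y)"
    and scale: "\<And>c x. P x \<Longrightarrow> P (scale_racah c x)"
    and mult: "\<And>x y. P x \<Longrightarrow> P y \<Longrightarrow> P (x * y)"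
  shows "P (x :: 'f::field racah)"
proof -
  have gen: "P (abs_racah (free_gen g))" for g
    using assms(2-5) by (cases g) (simp_all add: racah_A_def racah_B_def racah_C_def racah_D_def)
  have word: "P (abs_racah (Poly_Mapping.single w 1))" for w
  proof (induction w)
    case Nil
    then show ?case
      using \<open>P 1\<close> by (simp add: one_racah_def flip: zero_list_def)
  next
    case (Cons g w)
    have "Poly_Mapping.single (g # w) 1 = free_gen g * Poly_Mapping.single w (1 :: 'f)"
      by (simp add: free_gen_def mult_single plus_list_def)
    with mult[OF gen Cons] show ?case
      by (simp add: times_racah.abs_eq)
  qed
  have "P (abs_racah p)" for p
  proof (induction p rule: poly_mapping_single_induct)
    case zero
    then show ?case
      \<comment> \<open>Zero is obtained as 0 times the unit.\<close>
      using scale[OF \<open>P 1\<close>, of 0] by (simp add: zero_racah_def)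
  next
    case (single p w c)
    have "Poly_Mapping.single w c = Poly_Mapping.single 0 c * Poly_Mapping.single w (1 :: 'f)"
      by (simp add: mult_single)
    with add[OF single scale[OF word[of w], of c]] show ?case
      by (simp add: plus_racah.abs_eq scale_racah.abs_eq)
  qed
  then show ?thesis
    by (metis Quotient3_abs_rep Quotient3_racah)
qed

lemma racah_antiautomorphism_ext:
  assumes f: "algebra_antiautomorphism scale_racah f"
    and g: "algebra_antiautomorphism scale_racah g"
    and "f racah_A = g racah_A" "f racah_B = g racah_B"
      "f racah_C = g racah_C" "f racah_D = g racah_D"
  shows "f = g"
proof
  interpret f: Vector_Spaces.linear scale_racah scale_racah f
    using f by (simp add: algebra_antiautomorphism_def)
  interpret g: Vector_Spaces.linear scale_racah scale_racah g
    using g by (simp add: algebra_antiautomorphism_def)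
  show "f x = g x" for x
    using assms
    by (induction x rule: racah_induct)
      (simp_all add: algebra_antiautomorphism_def f.add g.add f.scale g.scale)
qed

section \<open>Descent to the quotient and construction of \<sigma> and \<tau>\<close>

text \<open>The hypotheses are the defining relations read in the opposite algebra, hence the
  exchanged arguments of the commutators. They make every relator vanish, and with it the
  ideal.\<close>

lemma anti_eval_racah_ideal:
  assumes "commutator (h Gen_B) (h Gen_A) = 2 * h Gen_D"
    and "commutator (h Gen_C) (h Gen_B) = 2 * h Gen_D"
    and "commutator (h Gen_A) (h Gen_C) = 2 * h Gen_D"
    and "\<And>x. commutator (anti_eval h free_alpha) x = 0"
    and "\<And>x. commutator (anti_eval h free_beta) x = 0"
    and "\<And>x. commutator (anti_eval h free_gamma) x = 0"
    and "p \<in> racah_ideal"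
  shows "anti_eval h p = 0"
  using \<open>p \<in> racah_ideal\<close>
proof induction
  case (relator r x y)
  \<comment> \<open>Reversal moves the central element to the second argument of the
    commutator.\<close>
  have "commutator z (anti_eval h u) = 0" if "u \<in> {free_alpha, free_beta, free_gamma}" for u z
    using assms(4-6)[of z] that by (auto simp: commutator_def)
  then have "anti_eval h r = 0"
    using relator assms(1-3)
    by (auto simp: racah_relators_def anti_eval_diff anti_eval_commutator anti_eval_add mult_2)
  then show ?case
    by (simp add: anti_eval_mult)
qed (simp_all add: anti_eval_add)

fun sigma_gen :: "racah_gen \<Rightarrow> 'f::field racah" where
  "sigma_gen Gen_A = racah_B"
| "sigma_gen Gen_B = racah_A"
| "sigma_gen Gen_C = racah_C"
| "sigma_gen Gen_D = racah_D"

text \<open>The sign at D compensates for the reversal: [A,B] is sent to [C,B] = -2D. For \<sigma>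
  the swap of A and B already does this.\<close>

fun tau_gen :: "racah_gen \<Rightarrow> 'f::field racah" where
  "tau_gen Gen_A = racah_B"
| "tau_gen Gen_B = racah_C"
| "tau_gen Gen_C = racah_A"
| "tau_gen Gen_D = - racah_D"

text \<open>Term by term: for instance \<alpha> goes to [D,B] + CB - BA, which is -\<beta>.\<close>

lemma anti_eval_sigma_gen:
  "anti_eval sigma_gen free_alpha = - racah_beta"
  "anti_eval sigma_gen free_beta = - racah_alpha"
  "anti_eval sigma_gen free_gamma = - racah_gamma"
  by (simp_all add: free_alpha_def free_beta_def free_gamma_def racah_alpha_def racah_beta_def
      racah_gamma_def anti_eval_add anti_eval_diff anti_eval_mult commutator_def)

text \<open>Here, unlike for \<open>\<sigma>\<close>, the images agree only modulo \<open>[A,B] = [B,C] = [C,A]\<close>.\<close>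

lemma anti_eval_tau_gen:
  "anti_eval tau_gen free_alpha = (racah_beta :: 'f::field racah)"
  "anti_eval tau_gen free_beta = racah_gamma"
  "anti_eval tau_gen free_gamma = racah_alpha"
  by (simp_all add: racah_commutators[unfolded commutator_def diff_eq_eq]
      free_alpha_def free_beta_def free_gamma_def racah_alpha_def racah_beta_def racah_gamma_def
      anti_eval_add anti_eval_diff anti_eval_mult commutator_def algebra_simps)

lemma commutator_uminus_left: "commutator (- x) y = - commutator x y"
  by (simp add: commutator_def)

lemma commutator_swap: "commutator x y = - commutator y x"
  by (simp add: commutator_def)

lift_definition racah_sigma :: "'f::field racah \<Rightarrow> 'f racah" is "anti_eval sigma_gen"
proof -
  fix p q :: "'f racah_free"
  assume "racah_eq p q"
  then have "anti_eval sigma_gen (p - q) = 0"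
    by (intro anti_eval_racah_ideal)
      (simp_all add: racah_eq_def racah_commutators anti_eval_sigma_gen racah_central
        commutator_uminus_left)
  then show "anti_eval sigma_gen p = anti_eval sigma_gen q"
    by (simp add: anti_eval_diff)
qed

lift_definition racah_tau :: "'f::field racah \<Rightarrow> 'f racah" is "anti_eval tau_gen"
proof -
  fix p q :: "'f racah_free"
  assume "racah_eq p q"
  then have "anti_eval tau_gen (p - q) = 0"
    by (intro anti_eval_racah_ideal)
      (simp_all add: racah_eq_def racah_commutators anti_eval_tau_gen racah_central
        \<comment> \<open>The images of the three commutator relations involve [C,B], [A,C] and
          [B,A], each equal to -2D.\<close>
        commutator_swap[of racah_B racah_A] commutator_swap[of racah_C racah_B]
        commutator_swap[of racah_A racah_C])
  then show "anti_eval tau_gen p = anti_eval tau_gen q"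
    by (simp add: anti_eval_diff)
qed

lemma anti_eval_scale:
  "anti_eval h (Poly_Mapping.single 0 c * p) = scale_racah c (anti_eval h p)"
  by (simp add: anti_eval_mult anti_eval_single zero_list_def scale_racah_mult_right)

lemma racah_sigma_simps [simp]:
  "racah_sigma racah_A = racah_B"
  "racah_sigma racah_B = racah_A"
  "racah_sigma racah_C = racah_C"
  "racah_sigma racah_D = racah_D"
  "racah_sigma 1 = 1"
  "racah_sigma (x + y) = racah_sigma x + racah_sigma y"
  "racah_sigma (scale_racah c x) = scale_racah c (racah_sigma x)"
  "racah_sigma (x * y) = racah_sigma y * racah_sigma x"
proof -
  show "racah_sigma (x + y) = racah_sigma x + racah_sigma y"
    by (induction x rule: racah.abs_induct; induction y rule: racah.abs_induct)
      (simp add: racah_sigma.abs_eq plus_racah.abs_eq anti_eval_add)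
  show "racah_sigma (x * y) = racah_sigma y * racah_sigma x"
    by (induction x rule: racah.abs_induct; induction y rule: racah.abs_induct)
      (simp add: racah_sigma.abs_eq times_racah.abs_eq anti_eval_mult)
  show "racah_sigma (scale_racah c x) = scale_racah c (racah_sigma x)"
    by (induction x rule: racah.abs_induct)
      (simp add: racah_sigma.abs_eq scale_racah.abs_eq anti_eval_scale)
qed (simp_all add: racah_sigma.abs_eq one_racah_def racah_A_def racah_B_def racah_C_def
    racah_D_def anti_eval_one)

lemma racah_tau_simps [simp]:
  "racah_tau racah_A = racah_B"
  "racah_tau racah_B = racah_C"
  "racah_tau racah_C = racah_A"
  "racah_tau racah_D = - racah_D"
  "racah_tau 1 = 1"
  "racah_tau (x + y) = racah_tau x + racah_tau y"
  "racah_tau (scale_racah c x) = scale_racah c (racah_tau x)"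
  "racah_tau (x * y) = racah_tau y * racah_tau x"
proof -
  show "racah_tau (x + y) = racah_tau x + racah_tau y"
    by (induction x rule: racah.abs_induct; induction y rule: racah.abs_induct)
      (simp add: racah_tau.abs_eq plus_racah.abs_eq anti_eval_add)
  show "racah_tau (x * y) = racah_tau y * racah_tau x"
    by (induction x rule: racah.abs_induct; induction y rule: racah.abs_induct)
      (simp add: racah_tau.abs_eq times_racah.abs_eq anti_eval_mult)
  show "racah_tau (scale_racah c x) = scale_racah c (racah_tau x)"
    by (induction x rule: racah.abs_induct)
      (simp add: racah_tau.abs_eq scale_racah.abs_eq anti_eval_scale)
qed (simp_all add: racah_tau.abs_eq one_racah_def racah_A_def racah_B_def racah_C_def
    racah_D_def anti_eval_one)

text \<open>Connects the central elements with their representatives, on which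
  \<open>anti_eval\<close> has been computed.\<close>

lemma racah_central_abs:
  "racah_alpha = abs_racah free_alpha"
  "racah_beta = abs_racah free_beta"
  "racah_gamma = abs_racah free_gamma"
  by (simp_all add: racah_alpha_def racah_beta_def racah_gamma_def free_alpha_def free_beta_def
      free_gamma_def commutator_def racah_A_def racah_B_def racah_C_def racah_D_def
      plus_racah.abs_eq minus_racah.abs_eq times_racah.abs_eq)

lemma racah_sigma_central:
  "racah_sigma racah_alpha = - racah_beta"
  "racah_sigma racah_beta = - racah_alpha"
  "racah_sigma racah_gamma = - racah_gamma"
  using anti_eval_sigma_gen by (simp_all add: racah_central_abs racah_sigma.abs_eq)

lemma racah_tau_central:
  "racah_tau racah_alpha = racah_beta"
  "racah_tau racah_beta = racah_gamma"
  "racah_tau racah_gamma = racah_alpha"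
  using anti_eval_tau_gen by (simp_all add: racah_central_abs racah_tau.abs_eq)

lemma racah_tau_uminus [simp]: "racah_tau (- x) = - racah_tau x"
  using racah_tau_simps(7)[of "-1" x] by simp

lemma racah_sigma_uminus [simp]: "racah_sigma (- x) = - racah_sigma x"
  using racah_sigma_simps(7)[of "-1" x] by simp

section \<open>The dihedral relations\<close>

lemma racah_sigma_sigma: "racah_sigma (racah_sigma x) = x"
  by (induction x rule: racah_induct) simp_all

text \<open>\<tau> cycles A, B, C and negates D, and 6 is a multiple of both 3 and 2. An even number
  of reversals preserves the order of products, so agreement with the identity spreads from the
  generators.\<close>

lemma racah_tau_power6:
  "racah_tau (racah_tau (racah_tau (racah_tau (racah_tau (racah_tau x))))) = x"
  by (induction x rule: racah_induct) simp_all

text \<open>Applying \<tau> and then \<sigma> fixes A, swaps B and C, and negates D, which is an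
  involution on the generators.\<close>

lemma racah_sigma_tau_square: "racah_sigma (racah_tau (racah_sigma (racah_tau x))) = x"
  by (induction x rule: racah_induct) simp_all

lemma bij_racah_sigma: "bij racah_sigma"
  by (rule involuntory_imp_bij) (rule racah_sigma_sigma)

lemma bij_racah_tau: "bij racah_tau"
  \<comment> \<open>The fifth power of \<tau> is a two-sided inverse.\<close>
  by (rule bijI') (metis racah_tau_power6)+

lemma linear_racah_sigma: "Vector_Spaces.linear scale_racah scale_racah racah_sigma"
  by unfold_locales simp_all

lemma linear_racah_tau: "Vector_Spaces.linear scale_racah scale_racah racah_tau"
  by unfold_locales simp_all

section \<open>The action of words and of the dihedral group\<close>

fun gen_action :: "D6_gen \<Rightarrow> 'f::field racah \<Rightarrow> 'f racah" where
  "gen_action Gen_sigma = racah_sigma"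
| "gen_action Gen_tau = racah_tau"

definition letter_action :: "D6_gen \<times> bool \<Rightarrow> 'f::field racah \<Rightarrow> 'f racah"
  where "letter_action l = (if snd l then gen_action (fst l) else inv_into UNIV (gen_action (fst l)))"

text \<open>\<open>foldr\<close> applies the last letter first, so concatenation becomes composition
  in the same order.\<close>

definition word_action :: "D6_word \<Rightarrow> 'f::field racah \<Rightarrow> 'f racah"
  where "word_action w = foldr letter_action w"

lemma word_action_append: "word_action (u @ v) = word_action u \<circ> word_action v"
  by (simp add: word_action_def fun_eq_iff)

lemma bij_gen_action: "bij (gen_action g)"
  by (cases g) (simp_all add: bij_racah_sigma bij_racah_tau)

lemma letter_action_cancel: "letter_action (g, b) (letter_action (g, \<not> b) x) = x"
  by (simp add: letter_action_def bij_gen_action bij_is_surj bij_is_inj surj_f_inv_f)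

lemma bij_letter_action: "bij (letter_action l)"
  by (simp add: letter_action_def bij_gen_action bij_imp_bij_inv)

lemma bij_word_action: "bij (word_action w)"
proof (induction w)
  case (Cons l w)
  from bij_comp[OF this bij_letter_action[of l]] show ?case
    by (simp add: word_action_def comp_def)
qed (simp add: word_action_def bij_id[unfolded id_def])

text \<open>Induction over the rules of \<open>D6_eq\<close>: congruence under concatenation comes
  from composition, cancellation from bijectivity, and the three relators from the identities for
  \<sigma> and \<tau>.\<close>

lift_definition D6_action :: "D6 \<Rightarrow> 'f::field racah \<Rightarrow> 'f racah" is word_action
proof -
  fix u v :: D6_word
  assume "D6_eq u v"
  then show "(word_action u :: 'f racah \<Rightarrow> 'f racah) = word_action v"
  proof induction
    case (append u u' v v')
    then show ?case
      by (simp add: word_action_append)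
  next
    case (cancel g b)
    then show ?case
      by (simp add: word_action_def letter_action_cancel fun_eq_iff)
  \<comment> \<open>\<open>numeral_eq_Suc\<close> unrolls \<open>replicate 6\<close> into six
    letters.\<close>
  qed (simp_all add: word_action_def letter_action_def fun_eq_iff numeral_eq_Suc
        racah_sigma_sigma racah_tau_power6[unfolded numeral_eq_Suc] racah_sigma_tau_square)
qed

lemma D6_action_sigma: "D6_action D6_sigma = racah_sigma"
  by transfer (simp add: word_action_def letter_action_def)

lemma D6_action_tau: "D6_action D6_tau = racah_tau"
  by transfer (simp add: word_action_def letter_action_def)

section \<open>Actions are determined by the two generators\<close>

text \<open>On \<open>UNIV\<close> extensionality is vacuous, so \<open>BijGroup UNIV\<close>
  consists of all bijections under ordinary composition.\<close>

lemma group_action_D6_iff: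
  "group_action D6_group UNIV \<phi> \<longleftrightarrow>
    (\<forall>x. bij (\<phi> x)) \<and> (\<forall>x y. \<phi> (D6_mult x y) = \<phi> x \<circ> \<phi> y)"
proof -
  have "group_action D6_group UNIV \<phi> \<longleftrightarrow> \<phi> \<in> hom D6_group (BijGroup UNIV)"
    by (simp add: group_action_def group_hom_def group_hom_axioms_def group_D6_group
        group_BijGroup)
  also have "\<dots> \<longleftrightarrow> (\<forall>x. bij (\<phi> x)) \<and> (\<forall>x y. \<phi> (D6_mult x y) = \<phi> x \<circ> \<phi> y)"
    by (auto simp: hom_def BijGroup_def Bij_def D6_group_def extensional_def compose_def
        restrict_def fun_eq_iff Pi_iff)
  finally show ?thesis .
qed

lemma D6_action_group_action: "group_action D6_group UNIV D6_action"
  unfolding group_action_D6_iff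
  by (transfer; simp add: bij_word_action word_action_append)

text \<open>Induction over words, once the two actions agree on the empty word and on single
  letters, inverse ones included.\<close>

lemma D6_group_action_ext:
  assumes \<phi>: "group_action D6_group UNIV \<phi>" and \<psi>: "group_action D6_group UNIV \<psi>"
    and gens: "\<phi> D6_sigma = \<psi> D6_sigma" "\<phi> D6_tau = \<psi> D6_tau"
  shows "\<phi> = \<psi>"
proof -
  have hom: "\<phi> (abs_D6 (u @ v)) = \<phi> (abs_D6 u) \<circ> \<phi> (abs_D6 v)"
    "\<psi> (abs_D6 (u @ v)) = \<psi> (abs_D6 u) \<circ> \<psi> (abs_D6 v)" for u v
    using \<phi> \<psi> by (simp_all add: group_action_D6_iff flip: D6_mult.abs_eq)
  have bij: "bij (\<phi> x)" "bij (\<psi> x)" for x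
    using \<phi> \<psi> by (simp_all add: group_action_D6_iff)
  \<comment> \<open>The image of the unit is an idempotent injection, hence the identity.\<close>
  have nil: "\<phi> (abs_D6 []) = id" "\<psi> (abs_D6 []) = id"
    using hom[of "[]" "[]"] bij[of "abs_D6 []"]
    by (simp_all add: fun_eq_iff bij_is_inj inj_eq)
  have pos: "\<phi> (abs_D6 [(g, True)]) = \<psi> (abs_D6 [(g, True)])" for g
    using gens by (cases g) (simp_all add: D6_sigma_def D6_tau_def)
  have letter: "\<phi> (abs_D6 [l]) = \<psi> (abs_D6 [l])" for l
  proof (cases l)
    case (Pair g b)
    have "abs_D6 ([(g, False)] @ [(g, True)]) = abs_D6 []"
      using D6_eq.cancel[of g False] by (simp add: D6.abs_eq_iff)
    \<comment> \<open>Both composites are the identity, because the two actions agree on the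
      positive letter; that letter acts surjectively and can be cancelled on the right.\<close>
    then have "\<phi> (abs_D6 [(g, False)]) \<circ> \<phi> (abs_D6 [(g, True)]) =
        \<psi> (abs_D6 [(g, False)]) \<circ> \<phi> (abs_D6 [(g, True)])"
      using hom[of "[(g, False)]" "[(g, True)]"] nil pos[of g] by simp
    then have "\<phi> (abs_D6 [(g, False)]) = \<psi> (abs_D6 [(g, False)])"
      using bij_is_surj[OF bij(1)[of "abs_D6 [(g, True)]"]]
      by (metis (no_types) comp_apply ext surjD)
    with pos Pair show ?thesis
      by (cases b) simp_all
  qed
  have "\<phi> (abs_D6 w) = \<psi> (abs_D6 w)" for w
  proof (induction w)
    case (Cons l w)
    then show ?case
      using hom[of "[l]" w] letter by simp
  qed (simp add: nil)
  then show ?thesis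
    by (metis Quotient3_abs_rep Quotient3_D6 ext)
qed

theorem proposition4p1:
  assumes "CHAR('f::field) \<noteq> 2"
  shows "\<exists>!\<phi> :: D6 \<Rightarrow> 'f racah \<Rightarrow> 'f racah.
    group_action D6_group UNIV \<phi> \<and>
    (algebra_antiautomorphism scale_racah (\<phi> D6_sigma) \<and>
      \<phi> D6_sigma racah_A = racah_B \<and>
      \<phi> D6_sigma racah_B = racah_A \<and>
      \<phi> D6_sigma racah_C = racah_C \<and>
      \<phi> D6_sigma racah_D = racah_D \<and>
      \<phi> D6_sigma racah_alpha = - racah_beta \<and>
      \<phi> D6_sigma racah_beta = - racah_alpha \<and>
      \<phi> D6_sigma racah_gamma = - racah_gamma \<and>
      \<phi> D6_sigma racah_delta = racah_delta) \<and>
    (algebra_antiautomorphism scale_racah (\<phi> D6_tau) \<and>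
      \<phi> D6_tau racah_A = racah_B \<and>
      \<phi> D6_tau racah_B = racah_C \<and>
      \<phi> D6_tau racah_C = racah_A \<and>
      \<phi> D6_tau racah_D = - racah_D \<and>
      \<phi> D6_tau racah_alpha = racah_beta \<and>
      \<phi> D6_tau racah_beta = racah_gamma \<and>
      \<phi> D6_tau racah_gamma = racah_alpha \<and>
      \<phi> D6_tau racah_delta = racah_delta)"
proof (rule ex1I[where a = D6_action], goal_cases)
  case 1
  then show ?case
    \<comment> \<open>\<delta> is fixed because \<sigma> and \<tau> permute its three summands;
      \<open>add_ac\<close> restores their order.\<close>
    using D6_action_group_action
    by (simp add: D6_action_sigma D6_action_tau algebra_antiautomorphism_def linear_racah_sigma
        linear_racah_tau bij_racah_sigma bij_racah_tau racah_sigma_central racah_tau_central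
        racah_delta_def add_ac)
next
  case (2 \<psi>)
  \<comment> \<open>Antiautomorphisms with the same values on A, B, C, D coincide.\<close>
  then have "\<psi> D6_sigma = racah_sigma" "\<psi> D6_tau = racah_tau"
    by (auto intro!: racah_antiautomorphism_ext simp: algebra_antiautomorphism_def
        linear_racah_sigma linear_racah_tau bij_racah_sigma bij_racah_tau)
  with 2 show ?case
    by (intro D6_group_action_ext)
      (simp_all add: D6_action_group_action D6_action_sigma D6_action_tau)
qed

end
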